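(* Let $(\mathcal{C},\varphi,\varphi')$ be an infinitesimal $*$-probability space and let $a,b\in\mathcal{C}$ be such that $(\mathcal{A}_a,\mathring{\mathcal{A}}_b)$ is infinitesimally monotone independent, where $\mathcal{A}_a$ is the (not necessarily unital) $*$-algebra generated by $a$ and $\mathring{\mathcal{A}}_b$ is the $*$-algebra generated by $b$ and $1$. Let $p=ab+ba$ and $q=i(ab-ba)$. Then for every integer $k\geq1$: (1) if $\varphi(b^2)\neq0$, then $$\begin{aligned}\varphi'(p^k)={}&\frac{\varphi(a^k)}{4\sqrt{\varphi(b^2)}\,\varphi(b^2)}\Big[(\varphi(b)+\sqrt{\varphi(b^2)})^k\Big(2(k+1)\varphi'(b)\varphi(b^2)-\varphi'(b^2)\big[\varphi(b)-k\sqrt{\varphi(b^2)}\big]\Big)\\&\qquad-(\varphi(b)-\sqrt{\varphi(b^2)})^k\Big(2(k+1)\varphi'(b)\varphi(b^2)-\varphi'(b^2)\big[\varphi(b)+k\sqrt{\varphi(b^2)}\big]\Big)\Big]\\&+\frac{\varphi'(a^k)}{2\sqrt{\varphi(b^2)}}\left([\varphi(b)+\sqrt{\varphi(b^2)}]^{k+1}-[\varphi(b)-\sqrt{\varphi(b^2)}]^{k+1}\right);\end{aligned}$$ (2) $$\begin{aligned}\varphi'(q^k)={}&\frac{\varphi(a^k)\,k}{4}\left(1+(-1)^k\right)\left(\sqrt{\varphi(b^2)-\varphi(b)^2}\right)^{k-2}\left(\varphi'(b^2)-2\varphi(b)\varphi'(b)\right)\\&+\frac{\varphi'(a^k)}{2}\left(1+(-1)^k\right)\left(\sqrt{\varphi(b^2)-\varphi(b)^2}\right)^k.\end{aligned}$$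 Here $\sqrt{\cdot}$ denotes any fixed choice of complex square root; in (2), for $k$ odd the right-hand side is read as $0$ (because of the factor $1+(-1)^k$), and a zeroth power is read as $1$.
   Context: A $*$-probability space is a pair $(\mathcal{C},\varphi)$ where $\mathcal{C}$ is a unital complex $*$-algebra and $\varphi:\mathcal{C}\to\mathbb{C}$ is linear with $\varphi(1)=1$ and $\varphi(c^*c)\geq 0$ for all $c\in\mathcal{C}$. An infinitesimal $*$-probability space is a triple $(\mathcal{C},\varphi,\varphi')$ where $(\mathcal{C},\varphi)$ is a $*$-probability space and $\varphi':\mathcal{C}\to\mathbb{C}$ is a linear functional with $\varphi'(1)=0$ and $\varphi'(c^* )=\overline{\varphi'(c)}$ for all $c\in\mathcal{C}$. For $*$-subalgebras $\mathcal{A},\mathcal{B}$ of $\mathcal{C}$ (not necessarily unital), $(\mathcal{A},\mathcal{B})$ is infinitesimally monotone independent if $$\varphi(b_0a_1b_1\cdots a_nb_n)=\varphi(a_1\cdots a_n)\varphi(b_0)\varphi(b_1)\cdots\varphi(b_n)$$ and $$\varphi'(b_0a_1b_1\cdots a_nb_n)=\varphi'(a_1\cdots a_n)\varphi(b_0)\cdots\varphi(b_n)+\varphi(a_1\cdots a_n)\sum_{j=0}^n\varphi(b_0)\cdots\varphi(b_{j-1})\varphi'(b_j)\varphi(b_{j+1})\cdots\varphi(b_n)$$ for all $n\ge1$, $a_1,\dots,a_n\in\mathcal{A}$, $b_1,\dots,b_{n-1}\in\mathcal{B}$, and $b_0,b_n$ each either $1$ or an element of $\mathcal{B}$. *)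

theory Defs
  imports Complex_Main "HOL-Library.Nonpos_Ints"
begin

locale star_algebra = vector_space scale
  for scale :: "complex \<Rightarrow> 'c::ring_1 \<Rightarrow> 'c" +
  fixes star :: "'c \<Rightarrow> 'c"
  assumes scale_mult_left: "scale z x * y = scale z (x * y)"
    and scale_mult_right: "x * scale z y = scale z (x * y)"
    and star_star: "star (star x) = x"
    and star_add: "star (x + y) = star x + star y"
    and star_mult: "star (x * y) = star y * star x"
    and star_scale: "star (scale z x) = scale (cnj z) (star x)"
begin

text \<open>Subalgebras need not contain the unit.\<close>

definition star_subalgebra :: "'c set \<Rightarrow> bool" where
  "star_subalgebra A \<longleftrightarrow>
     subspace A \<and> (\<forall>x\<in>A. \<forall>y\<in>A. x * y \<in> A) \<and> (\<forall>x\<in>A. star x \<in> A)"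

definition generated_star_algebra :: "'c set \<Rightarrow> 'c set" where
  "generated_star_algebra S = star_subalgebra hull S"

lemma star_subalgebra_generated: "star_subalgebra (generated_star_algebra S)"
  unfolding generated_star_algebra_def
  by (rule hull_in) (auto simp: star_subalgebra_def intro: subspace_Inter)

end

locale star_prob_space = star_algebra scale star
  for scale :: "complex \<Rightarrow> 'c::ring_1 \<Rightarrow> 'c" and star :: "'c \<Rightarrow> 'c" +
  fixes \<phi> :: "'c \<Rightarrow> complex"
  assumes linear_phi: "Vector_Spaces.linear scale (*) \<phi>"
    and phi_one: "\<phi> 1 = 1"
    and phi_nonneg: "\<phi> (star c * c) \<in> \<real>\<^sub>\<ge>\<^sub>0"

locale infinitesimal_star_prob_space = star_prob_space scale star \<phi>
  for scale :: "complex \<Rightarrow> 'c::ring_1 \<Rightarrow> 'c" and star :: "'c \<Rightarrow> 'c"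
    and \<phi> :: "'c \<Rightarrow> complex" +
  fixes \<phi>' :: "'c \<Rightarrow> complex"
  assumes linear_phi': "Vector_Spaces.linear scale (*) \<phi>'"
    and phi'_one: "\<phi>' 1 = 0"
    and phi'_star: "\<phi>' (star c) = cnj (\<phi>' c)"
begin

text \<open>
  The non-commutative word \<open>b\<^sub>0 a\<^sub>1 b\<^sub>1 \<dots> a\<^sub>n b\<^sub>n\<close> is written as
  \<open>b\<^sub>0 (a\<^sub>1 b\<^sub>1) \<dots> (a\<^sub>n b\<^sub>n)\<close>, with \<open>prod_list\<close> keeping the order of the factors.
\<close>

definition infinitesimally_monotone_independent :: "'c set \<Rightarrow> 'c set \<Rightarrow> bool" where
  "infinitesimally_monotone_independent A B \<longleftrightarrow>
     star_subalgebra A \<and> star_subalgebra B \<and>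
     (\<forall>n\<ge>1. \<forall>a b :: nat \<Rightarrow> 'c.
        (\<forall>j\<in>{1..n}. a j \<in> A) \<and> (\<forall>j\<in>{1..<n}. b j \<in> B) \<and>
        (b 0 = 1 \<or> b 0 \<in> B) \<and> (b n = 1 \<or> b n \<in> B) \<longrightarrow>
        \<phi> (b 0 * (\<Prod>j\<leftarrow>[1..<Suc n]. a j * b j)) =
          \<phi> (\<Prod>j\<leftarrow>[1..<Suc n]. a j) * (\<Prod>j=0..n. \<phi> (b j)) \<and>
        \<phi>' (b 0 * (\<Prod>j\<leftarrow>[1..<Suc n]. a j * b j)) =
          \<phi>' (\<Prod>j\<leftarrow>[1..<Suc n]. a j) * (\<Prod>j=0..n. \<phi> (b j)) +
          \<phi> (\<Prod>j\<leftarrow>[1..<Suc n]. a j) *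
            (\<Sum>j=0..n. (\<Prod>i\<in>{0..<j}. \<phi> (b i)) * \<phi>' (b j) * (\<Prod>i\<in>{j<..n}. \<phi> (b i))))"

end

end

theory Submission imports Defs begin

text \<open>
  By independence, \<open>\<phi>\<close> and \<open>\<phi>'\<close> of a word \<open>b\<^sub>0 a b\<^sub>1 \<dots> a b\<^sub>n\<close> are \<open>\<phi>(a\<^sup>n)\<close> times a product of
  numbers, and its formal derivative. For \<open>x = \<alpha> ab + \<beta> ba\<close>, multiplying out one factor of
  \<open>x\<^sup>k\<close> at a time therefore turns the contributions \<open>u\<^sub>k\<close> of \<open>x\<^sup>k\<close> and \<open>v\<^sub>k\<close> of \<open>b x\<^sup>k\<close> into a
  linear recursion with matrix \<open>((\<beta> \<phi>(b), \<alpha>), (\<beta> \<phi>(b\<^sup>2), \<alpha> \<phi>(b)))\<close>, whose eigenvalues are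
  \<open>\<phi>(b) \<plusminus> \<surd>\<phi>(b\<^sup>2)\<close> for \<open>p\<close> and \<open>\<plusminus> \<surd>(\<phi>(b\<^sup>2) - \<phi>(b)\<^sup>2)\<close> for \<open>q\<close>; the sequences \<open>u'\<close>, \<open>v'\<close> for
  \<open>\<phi>'\<close> solve the formally differentiated recursion.
\<close>

section \<open>Products, their formal derivatives, and words\<close>

definition leibniz_sum :: "(nat \<Rightarrow> complex) \<Rightarrow> (nat \<Rightarrow> complex) \<Rightarrow> nat \<Rightarrow> complex" where
  "leibniz_sum f g n = (\<Sum>j<n. (\<Prod>i<j. f i) * g j * (\<Prod>i\<in>{j<..<n}. f i))"

lemma leibniz_sum_0 [simp]: "leibniz_sum f g 0 = 0"
  by (simp add: leibniz_sum_def)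

lemma leibniz_sum_Suc:
  "leibniz_sum f g (Suc n) = leibniz_sum f g n * f n + (\<Prod>i<n. f i) * g n"
proof -
  have *: "(\<Prod>i\<in>{j<..<Suc n}. f i) = (\<Prod>i\<in>{j<..<n}. f i) * f n" if "j < n" for j
  proof -
    have "{j<..<Suc n} = insert n {j<..<n}"
      using that by auto
    then show ?thesis
      by (simp add: mult.commute)
  qed
  have "{n<..<Suc n} = {}"
    by auto
  then show ?thesis
    by (simp add: leibniz_sum_def * sum_distrib_right mult.assoc)
qed

lemma leibniz_sum_cong:
  assumes "\<And>j. j < n \<Longrightarrow> f j = f' j" "\<And>j. j < n \<Longrightarrow> g j = g' j"
  shows "leibniz_sum f g n = leibniz_sum f' g' n"
  using assms by (induction n) (auto simp: leibniz_sum_Suc intro!: prod.cong)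

text \<open>The word ends in \<open>a\<close>, with the slot for the letter number \<open>n\<close>
  left open: the induction on the exponent fills it with \<open>1\<close>, \<open>b\<close> or
  \<open>b\<^sup>2\<close>.\<close>

definition word_prefix :: "'c::monoid_mult \<Rightarrow> (nat \<Rightarrow> 'c) \<Rightarrow> nat \<Rightarrow> 'c" where
  "word_prefix a f n = (\<Prod>j\<leftarrow>[0..<n]. f j * a)"

lemma word_prefix_0 [simp]: "word_prefix a f 0 = 1"
  by (simp add: word_prefix_def)

lemma word_prefix_Suc: "word_prefix a f (Suc n) = word_prefix a f n * f n * a"
  by (simp add: word_prefix_def mult.assoc)

lemma word_prefix_cong:
  "(\<And>j. j < n \<Longrightarrow> f j = g j) \<Longrightarrow> word_prefix a f n = word_prefix a g n"
  by (induction n) (auto simp: word_prefix_Suc)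

text \<open>Regroups from the pairs \<open>a * f j\<close> of the independence condition to the
  pairs \<open>f j * a\<close> of the prefix.\<close>

lemma word_prefix_eq:
  "f 0 * (\<Prod>j\<leftarrow>[1..<Suc n]. a * f j) = word_prefix a f n * f n"
  by (induction n) (simp_all add: word_prefix_Suc flip: mult.assoc)

lemma prod_list_replicate_upt: "(\<Prod>j\<leftarrow>[1..<Suc n]. a) = (a::'c::monoid_mult) ^ n"
  by (induction n) (simp_all add: power_Suc2 del: power_Suc)

section \<open>Independence for words and for powers of
  \<open>scale \<alpha> (a * b) + scale \<beta> (b * a)\<close>\<close>

context star_algebra
begin

lemma generated_superset: "S \<subseteq> generated_star_algebra S"
  unfolding generated_star_algebra_def by (rule hull_subset)

end

context infinitesimal_star_prob_space
begin

lemma phi_add: "\<phi> (x + y) = \<phi> x + \<phi> y"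
  and phi_scale: "\<phi> (scale z x) = z * \<phi> x"
  using linear_phi by (simp_all add: Vector_Spaces.linear_iff)

lemma phi'_add: "\<phi>' (x + y) = \<phi>' x + \<phi>' y"
  and phi'_scale: "\<phi>' (scale z x) = z * \<phi>' x"
  using linear_phi' by (simp_all add: Vector_Spaces.linear_iff)

lemma independent_word:
  assumes indep: "infinitesimally_monotone_independent A B"
    and "a \<in> A" "\<forall>j<n. f j \<in> B" "c \<in> B" "n \<ge> 1"
  shows "\<phi> (word_prefix a f n * c) = \<phi> (a ^ n) * ((\<Prod>j<n. \<phi> (f j)) * \<phi> c)"
    and "\<phi>' (word_prefix a f n * c) =
      \<phi>' (a ^ n) * ((\<Prod>j<n. \<phi> (f j)) * \<phi> c) +
      \<phi> (a ^ n) * (leibniz_sum (\<lambda>j. \<phi> (f j)) (\<lambda>j. \<phi>' (f j)) n * \<phi> c + (\<Prod>j<n. \<phi> (f j)) * \<phi>' c)"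
proof -
  \<comment> \<open>\<open>f\<close> is constrained only below \<open>n\<close>; putting
    \<open>c\<close> into slot \<open>n\<close> gives one sequence that meets the premises of
    independence and has the same prefix.\<close>
  define g where "g = f(n := c)"
  have pre: "word_prefix a g n = word_prefix a f n"
    by (rule word_prefix_cong) (simp add: g_def)
  have prod: "(\<Prod>j<n. \<phi> (g j)) = (\<Prod>j<n. \<phi> (f j))"
    by (rule prod.cong) (simp_all add: g_def)
  have leib: "leibniz_sum (\<lambda>j. \<phi> (g j)) (\<lambda>j. \<phi>' (g j)) n =
      leibniz_sum (\<lambda>j. \<phi> (f j)) (\<lambda>j. \<phi>' (f j)) n"
    by (rule leibniz_sum_cong) (simp_all add: g_def)
  have gn: "g n = c"
    by (simp add: g_def)
  have "(\<forall>j\<in>{1..n}. a \<in> A) \<and> (\<forall>j\<in>{1..<n}. g j \<in> B) \<and>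
      (g 0 = 1 \<or> g 0 \<in> B) \<and> (g n = 1 \<or> g n \<in> B)"
    using assms by (auto simp: g_def)
  then have "\<phi> (g 0 * (\<Prod>j\<leftarrow>[1..<Suc n]. a * g j)) =
          \<phi> (\<Prod>j\<leftarrow>[1..<Suc n]. a) * (\<Prod>j=0..n. \<phi> (g j)) \<and>
        \<phi>' (g 0 * (\<Prod>j\<leftarrow>[1..<Suc n]. a * g j)) =
          \<phi>' (\<Prod>j\<leftarrow>[1..<Suc n]. a) * (\<Prod>j=0..n. \<phi> (g j)) +
          \<phi> (\<Prod>j\<leftarrow>[1..<Suc n]. a) *
            (\<Sum>j=0..n. (\<Prod>i\<in>{0..<j}. \<phi> (g i)) * \<phi>' (g j) * (\<Prod>i\<in>{j<..n}. \<phi> (g i)))"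
    using indep \<open>n \<ge> 1\<close> unfolding infinitesimally_monotone_independent_def
    by (elim conjE allE[of _ n] allE[of _ "\<lambda>_. a"] allE[of _ g] impE) (assumption | blast)+
  moreover have "{0..n} = {..<Suc n}"
    by auto
  \<comment> \<open>Since \<open>{j<..n}\<close> is \<open>{j<..<Suc n}\<close>, the sum is the
    derivative of a product of \<open>Suc n\<close> factors, and its recursion splits off the last
    letter \<open>c\<close>.\<close>
  moreover have "(\<Sum>j=0..n. (\<Prod>i\<in>{0..<j}. \<phi> (g i)) * \<phi>' (g j) * (\<Prod>i\<in>{j<..n}. \<phi> (g i))) =
      leibniz_sum (\<lambda>j. \<phi> (g j)) (\<lambda>j. \<phi>' (g j)) (Suc n)"
    unfolding leibniz_sum_def
    by (rule sum.cong) (auto simp: atLeast0LessThan intro!: prod.cong arg_cong2[of _ _ _ _ "(*)"])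
  ultimately show "\<phi> (word_prefix a f n * c) = \<phi> (a ^ n) * ((\<Prod>j<n. \<phi> (f j)) * \<phi> c)"
    and "\<phi>' (word_prefix a f n * c) =
      \<phi>' (a ^ n) * ((\<Prod>j<n. \<phi> (f j)) * \<phi> c) +
      \<phi> (a ^ n) * (leibniz_sum (\<lambda>j. \<phi> (f j)) (\<lambda>j. \<phi>' (f j)) n * \<phi> c + (\<Prod>j<n. \<phi> (f j)) * \<phi>' c)"
    unfolding word_prefix_eq prod_list_replicate_upt
    by (simp_all add: leibniz_sum_Suc pre prod leib gn)
qed

text \<open>Induction on \<open>k\<close> for all prefixes at once, since multiplying out a factor
  of \<open>x ^ Suc k\<close> lengthens the prefix by an \<open>a\<close>. The powers with and
  without a leading \<open>b\<close> go together, since the summand \<open>a * b\<close> leaves its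
  \<open>b\<close> in front of \<open>x ^ k\<close>. The sum \<open>n + k\<close> counts the letters
  \<open>a\<close>; at \<open>k = 0\<close> the bound on it supplies the \<open>n \<ge> 1\<close>
  that independence asks for.\<close>

lemma independent_word_power:
  assumes indep: "infinitesimally_monotone_independent A B"
    and a: "a \<in> A" and b: "b \<in> B" and one: "1 \<in> B"
    and x: "x = scale \<alpha> (a * b) + scale \<beta> (b * a)"
    and u: "u 0 = 1" "\<And>k. u (Suc k) = \<alpha> * v k + \<beta> * \<phi> b * u k"
    and v: "v 0 = \<phi> b" "\<And>k. v (Suc k) = \<alpha> * \<phi> b * v k + \<beta> * \<phi> (b\<^sup>2) * u k"
    and u': "u' 0 = 0" "\<And>k. u' (Suc k) = \<alpha> * v' k + \<beta> * (\<phi>' b * u k + \<phi> b * u' k)"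
    and v': "v' 0 = \<phi>' b" "\<And>k. v' (Suc k) =
      \<alpha> * (\<phi>' b * v k + \<phi> b * v' k) + \<beta> * (\<phi>' (b\<^sup>2) * u k + \<phi> (b\<^sup>2) * u' k)"
    and f: "\<forall>j<n. f j \<in> B" and "n + k \<ge> 1"
  defines "P \<equiv> \<lambda>f n. \<Prod>j<n. \<phi> (f j)"
    and "D \<equiv> \<lambda>f. leibniz_sum (\<lambda>j. \<phi> (f j)) (\<lambda>j. \<phi>' (f j))"
  shows "\<phi> (word_prefix a f n * x ^ k) = \<phi> (a ^ (n + k)) * (P f n * u k) \<and>
    \<phi> (word_prefix a f n * b * x ^ k) = \<phi> (a ^ (n + k)) * (P f n * v k) \<and>
    \<phi>' (word_prefix a f n * x ^ k) =
      \<phi>' (a ^ (n + k)) * (P f n * u k) + \<phi> (a ^ (n + k)) * (D f n * u k + P f n * u' k) \<and>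
    \<phi>' (word_prefix a f n * b * x ^ k) =
      \<phi>' (a ^ (n + k)) * (P f n * v k) + \<phi> (a ^ (n + k)) * (D f n * v k + P f n * v' k)"
  using f \<open>n + k \<ge> 1\<close>
proof (induction k arbitrary: f n)
  case 0
  then have "n \<ge> 1" by simp
  note word = independent_word[of A B a n f, OF indep a 0(1) _ this]
  show ?case
    using word(1,2)[OF one] word(1,2)[OF b]
    by (simp add: u v u' v' phi_one phi'_one P_def D_def)
next
  case (Suc k)
  have ext_mem: "\<forall>j<Suc n. (f(n := c)) j \<in> B" if "c \<in> B" for c
    using Suc.prems(1) that by (auto simp: less_Suc_eq)
  have ext_prefix: "word_prefix a (f(n := c)) (Suc n) = word_prefix a f n * c * a" for c
    unfolding word_prefix_Suc using word_prefix_cong[of n "f(n := c)" f] by simp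
  have ext_P: "P (f(n := c)) (Suc n) = P f n * \<phi> c" for c
    by (simp add: P_def)
  have ext_D: "D (f(n := c)) (Suc n) = D f n * \<phi> c + P f n * \<phi>' c" for c
  proof -
    have "D (f(n := c)) n = D f n"
      unfolding D_def by (rule leibniz_sum_cong) simp_all
    then show ?thesis
      by (simp add: D_def P_def leibniz_sum_Suc)
  qed
  have bb: "b\<^sup>2 \<in> B"
    using indep b by (simp add: infinitesimally_monotone_independent_def star_subalgebra_def power2_eq_square)
  have IH: "\<phi> (word_prefix a f n * c * a * x ^ k) = \<phi> (a ^ (n + Suc k)) * (P f n * \<phi> c * u k) \<and>
    \<phi> (word_prefix a f n * c * a * b * x ^ k) = \<phi> (a ^ (n + Suc k)) * (P f n * \<phi> c * v k) \<and>
    \<phi>' (word_prefix a f n * c * a * x ^ k) =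
      \<phi>' (a ^ (n + Suc k)) * (P f n * \<phi> c * u k) +
      \<phi> (a ^ (n + Suc k)) * ((D f n * \<phi> c + P f n * \<phi>' c) * u k + P f n * \<phi> c * u' k) \<and>
    \<phi>' (word_prefix a f n * c * a * b * x ^ k) =
      \<phi>' (a ^ (n + Suc k)) * (P f n * \<phi> c * v k) +
      \<phi> (a ^ (n + Suc k)) * ((D f n * \<phi> c + P f n * \<phi>' c) * v k + P f n * \<phi> c * v' k)"
    if "c \<in> B" for c
    using Suc.IH[of "Suc n" "f(n := c)", OF ext_mem[OF that]]
    unfolding ext_prefix ext_P ext_D by simp
  have expand: "w * x ^ Suc k =
      scale \<alpha> (w * a * b * x ^ k) + scale \<beta> (w * b * a * x ^ k)" for w
    by (simp add: x distrib_left distrib_right scale_mult_left scale_mult_right mult.assoc)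
  \<comment> \<open>The slot before the new \<open>a\<close> holds \<open>1\<close> or
    \<open>b\<close> when \<open>x ^ Suc k\<close> is expanded, and \<open>b\<close> or
    \<open>b\<^sup>2\<close> when \<open>b * x ^ Suc k\<close> is.\<close>
  note IH1 = IH[OF one, unfolded phi_one phi'_one mult_1_right]
  note IHb = IH[OF b]
  note IHbb = IH[OF bb, unfolded power2_eq_square, folded mult.assoc, folded power2_eq_square]
  show ?case
    unfolding expand phi_add phi'_add phi_scale phi'_scale u v u' v'
    using IH1 IHb IHbb
    by (simp add: algebra_simps power2_eq_square)
qed

lemma independent_power:
  assumes indep: "infinitesimally_monotone_independent A B"
    and a: "a \<in> A" and b: "b \<in> B" and one: "1 \<in> B"
    and x: "x = scale \<alpha> (a * b) + scale \<beta> (b * a)"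
    and u: "u 0 = 1" "\<And>k. u (Suc k) = \<alpha> * v k + \<beta> * \<phi> b * u k"
    and v: "v 0 = \<phi> b" "\<And>k. v (Suc k) = \<alpha> * \<phi> b * v k + \<beta> * \<phi> (b\<^sup>2) * u k"
    and u': "u' 0 = 0" "\<And>k. u' (Suc k) = \<alpha> * v' k + \<beta> * (\<phi>' b * u k + \<phi> b * u' k)"
    and v': "v' 0 = \<phi>' b" "\<And>k. v' (Suc k) =
      \<alpha> * (\<phi>' b * v k + \<phi> b * v' k) + \<beta> * (\<phi>' (b\<^sup>2) * u k + \<phi> (b\<^sup>2) * u' k)"
    and "k \<ge> 1"
  shows "\<phi>' (x ^ k) = \<phi>' (a ^ k) * u k + \<phi> (a ^ k) * u' k"
  using independent_word_power[where u = u and v = v and u' = u' and v' = v' and n = 0,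
      OF indep a b one x u v u' v'] \<open>k \<ge> 1\<close>
  by simp

section \<open>Closed forms for the anticommutator and the commutator\<close>

lemma independent_anticommutator_power:
  assumes indep: "infinitesimally_monotone_independent A B"
    and mem: "a \<in> A" "b \<in> B" "1 \<in> B"
    and s: "s\<^sup>2 = \<phi> (b\<^sup>2)" "s \<noteq> 0" and "k \<ge> 1"
  shows "\<phi>' ((a * b + b * a) ^ k) =
    \<phi> (a ^ k) / (4 * s * \<phi> (b\<^sup>2)) *
      ((\<phi> b + s) ^ k *
         (2 * (of_nat k + 1) * \<phi>' b * \<phi> (b\<^sup>2) - \<phi>' (b\<^sup>2) * (\<phi> b - of_nat k * s))
       - (\<phi> b - s) ^ k *
         (2 * (of_nat k + 1) * \<phi>' b * \<phi> (b\<^sup>2) - \<phi>' (b\<^sup>2) * (\<phi> b + of_nat k * s)))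
    + \<phi>' (a ^ k) / (2 * s) * ((\<phi> b + s) ^ (k + 1) - (\<phi> b - s) ^ (k + 1))"
proof -
  define m m' n' where "m = \<phi> b" and "m' = \<phi>' b" and "n' = \<phi>' (b\<^sup>2)"
  \<comment> \<open>Solved from the eigenvector coordinates
    \<open>v k + s * u k = (m + s) ^ (k + 1)\<close> and
    \<open>v k - s * u k = (m - s) ^ (k + 1)\<close>.\<close>
  define u where "u k = ((m + s) ^ (k + 1) - (m - s) ^ (k + 1)) / (2 * s)" for k
  define v where "v k = ((m + s) ^ (k + 1) + (m - s) ^ (k + 1)) / 2" for k
  \<comment> \<open>\<open>u'\<close> and \<open>v'\<close> are the derivatives of \<open>u\<close>
    and \<open>v\<close> when \<open>m\<close> has derivative \<open>m'\<close> and \<open>s\<close>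
    has derivative \<open>n' / (2 * s)\<close>, as \<open>s\<^sup>2 = \<phi> (b\<^sup>2)\<close>
    forces.\<close>
  define u' where "u' k = ((m + s) ^ k * (2 * (of_nat k + 1) * m' * s\<^sup>2 - n' * (m - of_nat k * s))
      - (m - s) ^ k * (2 * (of_nat k + 1) * m' * s\<^sup>2 - n' * (m + of_nat k * s))) / (4 * s ^ 3)"
    for k
  define v' where "v' k = (of_nat k + 1) *
      ((m + s) ^ k * (2 * s * m' + n') + (m - s) ^ k * (2 * s * m' - n')) / (4 * s)" for k
  have "\<phi>' ((a * b + b * a) ^ k) = \<phi>' (a ^ k) * u k + \<phi> (a ^ k) * u' k"
  proof (rule independent_power[where u = u and v = v and u' = u' and v' = v' and \<alpha> = 1 and \<beta> = 1,
        OF indep mem _ _ _ _ _ _ _ _ _ \<open>k \<ge> 1\<close>], goal_cases)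
    \<comment> \<open>Cases 3, 5, 7 and 9 are the four recursions; the other goals are the shape of
      \<open>x\<close> and the initial values.\<close>
    case (3 k) then show ?case
      using s(2) by (simp add: u_def v_def flip: m_def) (simp add: field_simps)
  next
    case (5 k) then show ?case
      using s(2) by (simp add: u_def v_def flip: m_def s(1)) (simp add: field_simps power2_eq_square)
  next
    case (7 k)
    have "u' (Suc k) = 1 * v' k + 1 * (m' * u k + m * u' k)"
      using s(2) unfolding u'_def v'_def u_def power_Suc add_Suc_right One_nat_def add_0_right of_nat_Suc
      by (simp add: divide_simps) algebra
    then show ?case by (simp add: m_def m'_def)
  next
    case (9 k)
    have "v' (Suc k) = 1 * (m' * v k + m * v' k) + 1 * (n' * u k + s\<^sup>2 * u' k)"
      using s(2) unfolding u'_def v'_def u_def v_def power_Suc add_Suc_right One_nat_def add_0_right of_nat_Suc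
      by (simp add: divide_simps) algebra
    then show ?case by (simp add: m_def m'_def n'_def s(1))
  qed (use s(2) in \<open>simp_all add: u_def v_def u'_def v'_def m_def m'_def field_simps\<close>)
  moreover have "4 * s * s\<^sup>2 = 4 * s ^ 3"
    by (simp add: power2_eq_square power3_eq_cube)
  ultimately show ?thesis
    by (simp add: u_def u'_def m_def m'_def n'_def flip: s(1))
qed

text \<open>For \<alpha> = \<i> and \<beta> = -\<i> the recursion matrix has trace 0 and square
  \<open>d\<close> times the identity. The closed forms thus depend on the parity of
  \<open>k\<close> and involve only natural powers of \<open>d\<close>, so \<open>d = 0\<close> is
  covered as well.\<close>

lemma independent_commutator_power:
  assumes indep: "infinitesimally_monotone_independent A B"
    and mem: "a \<in> A" "b \<in> B" "1 \<in> B" and "k \<ge> 1"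
  defines "d \<equiv> \<phi> (b\<^sup>2) - (\<phi> b)\<^sup>2" and "d' \<equiv> \<phi>' (b\<^sup>2) - 2 * \<phi> b * \<phi>' b"
  shows "\<phi>' (scale \<i> (a * b - b * a) ^ k) =
    (if even k then \<phi> (a ^ k) * of_nat (k div 2) * d ^ (k div 2 - 1) * d' +
       \<phi>' (a ^ k) * d ^ (k div 2) else 0)"
proof -
  define m m' where "m = \<phi> b" and "m' = \<phi>' b"
  \<comment> \<open>The derivative of \<open>d ^ j\<close>; at \<open>j = 0\<close> the factor
    \<open>of_nat j\<close> makes the truncated exponent harmless.\<close>
  define e where "e j = of_nat j * d ^ (j - 1) * d'" for j
  have e_0: "e 0 = 0"
    by (simp add: e_def)
  have e_Suc: "e (Suc j) = d * e j + d' * d ^ j" for j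
    by (cases j) (simp_all add: e_def algebra_simps)
  define u where "u k = (if even k then d ^ (k div 2) else 0)" for k
  define v where "v k = (if even k then m * d ^ (k div 2) else - \<i> * d ^ Suc (k div 2))" for k
  define u' where "u' k = (if even k then e (k div 2) else 0)" for k
  define v' where "v' k = (if even k then m' * d ^ (k div 2) + m * e (k div 2)
    else - \<i> * e (Suc (k div 2)))" for k
  have n: "\<phi> (b\<^sup>2) = d + m\<^sup>2" and n': "\<phi>' (b\<^sup>2) = d' + 2 * m * m'"
    by (simp_all add: d_def d'_def m_def m'_def)
  have "\<phi>' (scale \<i> (a * b - b * a) ^ k) = \<phi>' (a ^ k) * u k + \<phi> (a ^ k) * u' k"
  proof (rule independent_power[where u = u and v = v and u' = u' and v' = v'
          and \<alpha> = \<i> and \<beta> = "-\<i>", OF indep mem _ _ _ _ _ _ _ _ _ \<open>k \<ge> 1\<close>], goal_cases)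
    case 1 then show ?case
      by (simp add: scale_right_diff_distrib)
  qed (auto simp: u_def v_def u'_def v'_def e_0 e_Suc power2_eq_square algebra_simps
        n[unfolded power2_eq_square] n'[unfolded power2_eq_square]
        elim!: evenE oddE simp flip: m_def m'_def)
  then show ?thesis
    by (simp add: u_def u'_def e_def)
qed

end

section \<open>The two formulas in terms of square roots\<close>

theorem corollary4p4:
  fixes scale :: "complex \<Rightarrow> 'c::ring_1 \<Rightarrow> 'c" and star :: "'c \<Rightarrow> 'c"
    and \<phi> \<phi>' :: "'c \<Rightarrow> complex" and a b p q :: 'c
    and rt :: "complex \<Rightarrow> complex" and k :: nat
  assumes "infinitesimal_star_prob_space scale star \<phi> \<phi>'"
    and "infinitesimal_star_prob_space.infinitesimally_monotone_independent scale star \<phi> \<phi>'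
           (star_algebra.generated_star_algebra scale star {a})
           (star_algebra.generated_star_algebra scale star {b, 1})"
    and "p = a * b + b * a"
    and "q = scale \<i> (a * b - b * a)"
    and "\<And>z. (rt z)\<^sup>2 = z"
    and "k \<ge> 1"
  shows "(\<phi> (b\<^sup>2) \<noteq> 0 \<longrightarrow>
      \<phi>' (p ^ k) =
        \<phi> (a ^ k) / (4 * rt (\<phi> (b\<^sup>2)) * \<phi> (b\<^sup>2)) *
          ((\<phi> b + rt (\<phi> (b\<^sup>2))) ^ k *
             (2 * (of_nat k + 1) * \<phi>' b * \<phi> (b\<^sup>2)
              - \<phi>' (b\<^sup>2) * (\<phi> b - of_nat k * rt (\<phi> (b\<^sup>2))))
           - (\<phi> b - rt (\<phi> (b\<^sup>2))) ^ k *
             (2 * (of_nat k + 1) * \<phi>' b * \<phi> (b\<^sup>2)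
              - \<phi>' (b\<^sup>2) * (\<phi> b + of_nat k * rt (\<phi> (b\<^sup>2)))))
        + \<phi>' (a ^ k) / (2 * rt (\<phi> (b\<^sup>2))) *
          ((\<phi> b + rt (\<phi> (b\<^sup>2))) ^ (k + 1) - (\<phi> b - rt (\<phi> (b\<^sup>2))) ^ (k + 1)))
    \<and>
      \<phi>' (q ^ k) =
        \<phi> (a ^ k) * of_nat k / 4 * (1 + (-1) ^ k)
          * rt (\<phi> (b\<^sup>2) - (\<phi> b)\<^sup>2) powi (int k - 2)
          * (\<phi>' (b\<^sup>2) - 2 * \<phi> b * \<phi>' b)
        + \<phi>' (a ^ k) / 2 * (1 + (-1) ^ k) * rt (\<phi> (b\<^sup>2) - (\<phi> b)\<^sup>2) ^ k"
proof -
  interpret infinitesimal_star_prob_space scale star \<phi> \<phi>'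
    by fact
  have mem: "a \<in> generated_star_algebra {a}" "b \<in> generated_star_algebra {b, 1}"
    "1 \<in> generated_star_algebra {b, 1}"
    using generated_superset by blast+
  note rt = \<open>\<And>z. (rt z)\<^sup>2 = z\<close>
  show ?thesis
  proof (intro conjI impI)
    assume "\<phi> (b\<^sup>2) \<noteq> 0"
    then have "rt (\<phi> (b\<^sup>2)) \<noteq> 0"
      using rt[of "\<phi> (b\<^sup>2)"] by auto
    from independent_anticommutator_power[OF assms(2) mem rt this \<open>k \<ge> 1\<close>]
    show "\<phi>' (p ^ k) =
        \<phi> (a ^ k) / (4 * rt (\<phi> (b\<^sup>2)) * \<phi> (b\<^sup>2)) *
          ((\<phi> b + rt (\<phi> (b\<^sup>2))) ^ k *
             (2 * (of_nat k + 1) * \<phi>' b * \<phi> (b\<^sup>2)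
              - \<phi>' (b\<^sup>2) * (\<phi> b - of_nat k * rt (\<phi> (b\<^sup>2))))
           - (\<phi> b - rt (\<phi> (b\<^sup>2))) ^ k *
             (2 * (of_nat k + 1) * \<phi>' b * \<phi> (b\<^sup>2)
              - \<phi>' (b\<^sup>2) * (\<phi> b + of_nat k * rt (\<phi> (b\<^sup>2)))))
        + \<phi>' (a ^ k) / (2 * rt (\<phi> (b\<^sup>2))) *
          ((\<phi> b + rt (\<phi> (b\<^sup>2))) ^ (k + 1) - (\<phi> b - rt (\<phi> (b\<^sup>2))) ^ (k + 1))"
      unfolding \<open>p = a * b + b * a\<close> .
  next
    define r where "r = rt (\<phi> (b\<^sup>2) - (\<phi> b)\<^sup>2)"
    \<comment> \<open>Folding writes \<open>d\<close> as \<open>r\<^sup>2\<close>, so the powers of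
      \<open>d\<close> become even powers of \<open>r\<close>.\<close>
    note comm = independent_commutator_power[OF assms(2) mem \<open>k \<ge> 1\<close>,
        folded \<open>q = scale \<i> (a * b - b * a)\<close> rt[of "\<phi> (b\<^sup>2) - (\<phi> b)\<^sup>2", folded r_def]]
    show "\<phi>' (q ^ k) =
        \<phi> (a ^ k) * of_nat k / 4 * (1 + (-1) ^ k)
          * rt (\<phi> (b\<^sup>2) - (\<phi> b)\<^sup>2) powi (int k - 2)
          * (\<phi>' (b\<^sup>2) - 2 * \<phi> b * \<phi>' b)
        + \<phi>' (a ^ k) / 2 * (1 + (-1) ^ k) * rt (\<phi> (b\<^sup>2) - (\<phi> b)\<^sup>2) ^ k"
      unfolding r_def[symmetric]
    proof (cases "even k")
      case True
      \<comment> \<open>The exponent \<open>int k - 2\<close> is then the natural number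
        \<open>2 * j\<close>, so no inverse of \<open>r\<close> occurs, and for \<open>k = 2\<close>
        the power is 1 even if \<open>r = 0\<close>.\<close>
      then obtain j where k: "k = 2 * Suc j"
        using \<open>k \<ge> 1\<close> by (metis evenE mult_0_right not0_implies_Suc not_one_le_zero)
      have "int k - 2 = int (2 * j)"
        by (simp add: k)
      then have "r powi (int k - 2) = (r\<^sup>2) ^ j"
        by (simp only: power_int_of_nat power_mult)
      moreover have "r ^ k = (r\<^sup>2) ^ Suc j"
        by (simp only: k power_mult)
      moreover have "k div 2 = Suc j"
        by (simp add: k)
      moreover have "(of_nat k :: complex) = 2 * of_nat (Suc j)"
        by (simp add: k)
      ultimately show "\<phi>' (q ^ k) =
          \<phi> (a ^ k) * of_nat k / 4 * (1 + (-1) ^ k) * r powi (int k - 2)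
            * (\<phi>' (b\<^sup>2) - 2 * \<phi> b * \<phi>' b)
          + \<phi>' (a ^ k) / 2 * (1 + (-1) ^ k) * r ^ k"
        using comm True by (simp only: diff_Suc_1 if_True) (simp add: field_simps)
    \<comment> \<open>For odd \<open>k\<close> the factor \<open>1 + (-1) ^ k\<close> is 0, also at
      \<open>k = 1\<close>, where the exponent of \<open>r\<close> is negative.\<close>
    qed (use comm in simp)
  qed
qed

end
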